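(* There is a category $\mathbf{Graph}_{CP}$ whose objects are connected graphs and whose morphisms are the cut-proper morphisms. There is a contravariant functor $\mathfrak C:\mathbf{Graph}_{CP}\to\mathbf{Bool}$ taking a connected graph $G$ to its cut algebra $\mathfrak C(G)$ and a cut-proper morphism $\phi:G_1\to G_2$ to a Boolean algebra homomorphism $\mathfrak C(\phi):\mathfrak C(G_2)\to\mathfrak C(G_1)$ such that $\mathfrak C(\phi)(A)=\phi^{-1}(A)\in\mathfrak C(G_1)$ for every $A\in\mathfrak C(G_2)$. The same assignment $\mathfrak C$ is also a well-defined contravariant functor from the category $\mathbf{Graph}_{LP}$ of connected graphs with strongly line-proper morphisms to $\mathbf{Bool}$.
   Context: Graphs are simple and undirected, possibly infinite. A graph homomorphism is a map of vertex sets sending adjacent vertices to adjacent vertices; composition is composition of maps. $\mathbf{Bool}$ is the category of Boolean algebras (the one-element algebra is allowed) and Boolean algebra homomorphisms. Cut algebra: for a graph $G$, $\mathfrak c(G)$ is the Boolean algebra of sets $A\subset V(G)$ such that only finitely many edges join $A$ to $V(G)\setminus A$; $I_G$ is the ideal of finite sets of vertices all of which have finite degree; $\mathfrak C(G)=\mathfrak c(G)/I_G$ (elements $A,B$ are identified when $A\,\Delta\,B\in I_G$). Elements of $\mathfrak C(G)$ are denoted by any of their representatives. Cut-proper: a graph homomorphism $\phi:G_1\to G_2$ is cut-proper if $\phi^{-1}:\mathfrak C(G_2)\to\mathfrak C(G_1)$ is well defined, i.e. if (i) whenever $A\subset V(G_2)$ is joined to $V(G_2)\setminus A$ by only finitely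 many edges, $\phi^{-1}(A)$ is joined to $\phi^{-1}(V(G_2)\setminus A)$ by only finitely many edges; and (ii) whenever $v\in V(G_2)$ has finite degree, $\phi^{-1}(v)$ is a finite set of vertices of finite degree. Strongly line-proper: a graph homomorphism $\phi:G_1\to G_2$ between connected graphs is strongly line-proper if for every edge $e\in E(G_2)$ the set of edges $\{u,v\}\in E(G_1)$ with $\{\phi(u),\phi(v)\}=e$ is finite. *)

theory Defs
  imports Main "HOL-Library.FuncSet" "HOL-Algebra.Congruence"
begin

section \<open>Categories and contravariant functors\<close>

text \<open>
  Hom-sets are indexed by a pair of objects and need not be disjoint; composition and the
  action of a functor on morphisms therefore also take the objects as arguments.
  \<open>Comp C X Y Z g f\<close> is the composite of \<open>f : X \<rightarrow> Y\<close> followed by \<open>g : Y \<rightarrow> Z\<close>.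
\<close>

record ('o, 'm) cat =
  Obj :: "'o set"
  Hom :: "'o \<Rightarrow> 'o \<Rightarrow> 'm set"
  Ident :: "'o \<Rightarrow> 'm"
  Comp :: "'o \<Rightarrow> 'o \<Rightarrow> 'o \<Rightarrow> 'm \<Rightarrow> 'm \<Rightarrow> 'm"

locale category =
  fixes C :: "('o, 'm) cat"
  assumes Ident_in_Hom: "X \<in> Obj C \<Longrightarrow> Ident C X \<in> Hom C X X"
    and Comp_in_Hom:
      "\<lbrakk>X \<in> Obj C; Y \<in> Obj C; Z \<in> Obj C; f \<in> Hom C X Y; g \<in> Hom C Y Z\<rbrakk>
        \<Longrightarrow> Comp C X Y Z g f \<in> Hom C X Z"
    and Comp_Ident_right:
      "\<lbrakk>X \<in> Obj C; Y \<in> Obj C; f \<in> Hom C X Y\<rbrakk> \<Longrightarrow> Comp C X X Y f (Ident C X) = f"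
    and Comp_Ident_left:
      "\<lbrakk>X \<in> Obj C; Y \<in> Obj C; f \<in> Hom C X Y\<rbrakk> \<Longrightarrow> Comp C X Y Y (Ident C Y) f = f"
    and Comp_assoc:
      "\<lbrakk>W \<in> Obj C; X \<in> Obj C; Y \<in> Obj C; Z \<in> Obj C;
        f \<in> Hom C W X; g \<in> Hom C X Y; h \<in> Hom C Y Z\<rbrakk>
        \<Longrightarrow> Comp C W Y Z h (Comp C W X Y g f) = Comp C W X Z (Comp C X Y Z h g) f"

locale contravariant_functor = dom: category C + cod: category D
  for C :: "('o, 'm) cat" and D :: "('p, 'n) cat" +
  fixes F :: "'o \<Rightarrow> 'p"
    and Fm :: "'o \<Rightarrow> 'o \<Rightarrow> 'm \<Rightarrow> 'n"
  assumes F_Obj: "X \<in> Obj C \<Longrightarrow> F X \<in> Obj D"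
    and Fm_Hom:
      "\<lbrakk>X \<in> Obj C; Y \<in> Obj C; f \<in> Hom C X Y\<rbrakk> \<Longrightarrow> Fm X Y f \<in> Hom D (F Y) (F X)"
    and Fm_Ident: "X \<in> Obj C \<Longrightarrow> Fm X X (Ident C X) = Ident D (F X)"
    and Fm_Comp:
      "\<lbrakk>X \<in> Obj C; Y \<in> Obj C; Z \<in> Obj C; f \<in> Hom C X Y; g \<in> Hom C Y Z\<rbrakk>
        \<Longrightarrow> Fm X Z (Comp C X Y Z g f) = Comp D (F Z) (F Y) (F X) (Fm X Y f) (Fm Y Z g)"


section \<open>The category of Boolean algebras\<close>

text \<open>
  The axioms are those of the locale \<^locale>\<open>abstract_boolean_algebra\<close>, relativised to a carrier.
  Bottom and top may coincide.
\<close>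

record 'a bool_alg = "'a partial_object" +
  ba_meet :: "'a \<Rightarrow> 'a \<Rightarrow> 'a"
  ba_join :: "'a \<Rightarrow> 'a \<Rightarrow> 'a"
  ba_compl :: "'a \<Rightarrow> 'a"
  ba_bot :: 'a
  ba_top :: 'a

locale boolean_alg =
  fixes B :: "'a bool_alg"
  assumes meet_closed: "\<lbrakk>x \<in> carrier B; y \<in> carrier B\<rbrakk> \<Longrightarrow> ba_meet B x y \<in> carrier B"
    and join_closed: "\<lbrakk>x \<in> carrier B; y \<in> carrier B\<rbrakk> \<Longrightarrow> ba_join B x y \<in> carrier B"
    and compl_closed: "x \<in> carrier B \<Longrightarrow> ba_compl B x \<in> carrier B"
    and bot_closed: "ba_bot B \<in> carrier B"
    and top_closed: "ba_top B \<in> carrier B"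
    and meet_assoc: "\<lbrakk>x \<in> carrier B; y \<in> carrier B; z \<in> carrier B\<rbrakk>
      \<Longrightarrow> ba_meet B (ba_meet B x y) z = ba_meet B x (ba_meet B y z)"
    and join_assoc: "\<lbrakk>x \<in> carrier B; y \<in> carrier B; z \<in> carrier B\<rbrakk>
      \<Longrightarrow> ba_join B (ba_join B x y) z = ba_join B x (ba_join B y z)"
    and meet_commute: "\<lbrakk>x \<in> carrier B; y \<in> carrier B\<rbrakk> \<Longrightarrow> ba_meet B x y = ba_meet B y x"
    and join_commute: "\<lbrakk>x \<in> carrier B; y \<in> carrier B\<rbrakk> \<Longrightarrow> ba_join B x y = ba_join B y x"
    and meet_join_distrib: "\<lbrakk>x \<in> carrier B; y \<in> carrier B; z \<in> carrier B\<rbrakk>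
      \<Longrightarrow> ba_meet B x (ba_join B y z) = ba_join B (ba_meet B x y) (ba_meet B x z)"
    and join_meet_distrib: "\<lbrakk>x \<in> carrier B; y \<in> carrier B; z \<in> carrier B\<rbrakk>
      \<Longrightarrow> ba_join B x (ba_meet B y z) = ba_meet B (ba_join B x y) (ba_join B x z)"
    and meet_top: "x \<in> carrier B \<Longrightarrow> ba_meet B x (ba_top B) = x"
    and join_bot: "x \<in> carrier B \<Longrightarrow> ba_join B x (ba_bot B) = x"
    and meet_compl: "x \<in> carrier B \<Longrightarrow> ba_meet B x (ba_compl B x) = ba_bot B"
    and join_compl: "x \<in> carrier B \<Longrightarrow> ba_join B x (ba_compl B x) = ba_top B"

text \<open>
  Maps between carriers are taken to be extensional (\<open>undefined\<close> off the domain), so that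
  equality of morphisms is equality of maps; likewise for graph morphisms below.
\<close>

definition ba_hom :: "'a bool_alg \<Rightarrow> 'b bool_alg \<Rightarrow> ('a \<Rightarrow> 'b) set" where
  "ba_hom A B = {h \<in> carrier A \<rightarrow>\<^sub>E carrier B.
     (\<forall>x\<in>carrier A. \<forall>y\<in>carrier A. h (ba_meet A x y) = ba_meet B (h x) (h y)) \<and>
     (\<forall>x\<in>carrier A. \<forall>y\<in>carrier A. h (ba_join A x y) = ba_join B (h x) (h y)) \<and>
     (\<forall>x\<in>carrier A. h (ba_compl A x) = ba_compl B (h x)) \<and>
     h (ba_bot A) = ba_bot B \<and> h (ba_top A) = ba_top B}"

definition Bool_cat :: "('a bool_alg, 'a \<Rightarrow> 'a) cat" where
  "Bool_cat =
    \<lparr>Obj = {B. boolean_alg B},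
     Hom = ba_hom,
     Ident = (\<lambda>B. \<lambda>x\<in>carrier B. x),
     Comp = (\<lambda>A B C g f. compose (carrier A) g f)\<rparr>"

text \<open>The quotient of a Boolean algebra by an ideal.\<close>

definition ba_cong :: "'a bool_alg \<Rightarrow> 'a set \<Rightarrow> ('a \<times> 'a) set" where
  "ba_cong B I = {(a, b). a \<in> carrier B \<and> b \<in> carrier B \<and>
     ba_join B (ba_meet B a (ba_compl B b)) (ba_meet B b (ba_compl B a)) \<in> I}"

definition ba_quot :: "'a bool_alg \<Rightarrow> 'a set \<Rightarrow> 'a set bool_alg" where
  "ba_quot B I =
    \<lparr>carrier = carrier B // ba_cong B I,
     ba_meet = (\<lambda>X Y. \<Union>a\<in>X. \<Union>b\<in>Y. ba_cong B I `` {ba_meet B a b}),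
     ba_join = (\<lambda>X Y. \<Union>a\<in>X. \<Union>b\<in>Y. ba_cong B I `` {ba_join B a b}),
     ba_compl = (\<lambda>X. \<Union>a\<in>X. ba_cong B I `` {ba_compl B a}),
     ba_bot = ba_cong B I `` {ba_bot B},
     ba_top = ba_cong B I `` {ba_top B}\<rparr>"


section \<open>Graphs and their cut algebras\<close>

record 'v ugraph =
  verts :: "'v set"
  edges :: "'v set set"

definition simple_graph :: "'v ugraph \<Rightarrow> bool" where
  "simple_graph G \<longleftrightarrow> (\<forall>e\<in>edges G. e \<subseteq> verts G \<and> card e = 2)"

text \<open>The empty graph counts as connected; the nonempty connected graphs form a full subcategory.\<close>

definition connected_graph :: "'v ugraph \<Rightarrow> bool" where
  "connected_graph G \<longleftrightarrow>
     simple_graph G \<and>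
     (\<forall>u\<in>verts G. \<forall>v\<in>verts G. (u, v) \<in> {(x, y). {x, y} \<in> edges G}\<^sup>*)"

definition edges_between :: "'v ugraph \<Rightarrow> 'v set \<Rightarrow> 'v set \<Rightarrow> 'v set set" where
  "edges_between G A B = {e \<in> edges G. \<exists>a\<in>A. \<exists>b\<in>B. e = {a, b}}"

definition finite_degree :: "'v ugraph \<Rightarrow> 'v \<Rightarrow> bool" where
  "finite_degree G v \<longleftrightarrow> finite {e \<in> edges G. v \<in> e}"

definition cut_sets :: "'v ugraph \<Rightarrow> 'v set set" where
  "cut_sets G = {A. A \<subseteq> verts G \<and> finite (edges_between G A (verts G - A))}"

definition cut_sets_alg :: "'v ugraph \<Rightarrow> 'v set bool_alg" where
  "cut_sets_alg G =
    \<lparr>carrier = cut_sets G,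
     ba_meet = (\<inter>),
     ba_join = (\<union>),
     ba_compl = (\<lambda>A. verts G - A),
     ba_bot = {},
     ba_top = verts G\<rparr>"

definition fin_ideal :: "'v ugraph \<Rightarrow> 'v set set" where
  "fin_ideal G = {A. A \<subseteq> verts G \<and> finite A \<and> (\<forall>v\<in>A. finite_degree G v)}"

definition cut_algebra :: "'v ugraph \<Rightarrow> 'v set set bool_alg" where
  "cut_algebra G = ba_quot (cut_sets_alg G) (fin_ideal G)"

definition cut_class :: "'v ugraph \<Rightarrow> 'v set \<Rightarrow> 'v set set" where
  "cut_class G A = ba_cong (cut_sets_alg G) (fin_ideal G) `` {A}"


section \<open>Graph morphisms\<close>

definition graph_hom :: "'u ugraph \<Rightarrow> 'v ugraph \<Rightarrow> ('u \<Rightarrow> 'v) \<Rightarrow> bool" where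
  "graph_hom G H \<phi> \<longleftrightarrow>
     \<phi> \<in> verts G \<rightarrow> verts H \<and> (\<forall>u v. {u, v} \<in> edges G \<longrightarrow> {\<phi> u, \<phi> v} \<in> edges H)"

definition preimage :: "'u ugraph \<Rightarrow> ('u \<Rightarrow> 'v) \<Rightarrow> 'v set \<Rightarrow> 'u set" where
  "preimage G \<phi> A = {u \<in> verts G. \<phi> u \<in> A}"

definition cut_proper :: "'u ugraph \<Rightarrow> 'v ugraph \<Rightarrow> ('u \<Rightarrow> 'v) \<Rightarrow> bool" where
  "cut_proper G H \<phi> \<longleftrightarrow>
     graph_hom G H \<phi> \<and>
     (\<forall>A. A \<subseteq> verts H \<and> finite (edges_between H A (verts H - A)) \<longrightarrow>
        finite (edges_between G (preimage G \<phi> A) (preimage G \<phi> (verts H - A)))) \<and>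
     (\<forall>v\<in>verts H. finite_degree H v \<longrightarrow>
        finite (preimage G \<phi> {v}) \<and> (\<forall>u\<in>preimage G \<phi> {v}. finite_degree G u))"

definition strongly_line_proper :: "'u ugraph \<Rightarrow> 'v ugraph \<Rightarrow> ('u \<Rightarrow> 'v) \<Rightarrow> bool" where
  "strongly_line_proper G H \<phi> \<longleftrightarrow>
     graph_hom G H \<phi> \<and>
     (\<forall>e\<in>edges H. finite {{u, v} | u v. {u, v} \<in> edges G \<and> {\<phi> u, \<phi> v} = e})"

text \<open>
  The type variable \<open>'v\<close> plays the role of the universe: the objects are all connected
  graphs whose vertices are of type \<open>'v\<close>.
\<close>

definition Graph_CP :: "('v ugraph, 'v \<Rightarrow> 'v) cat" where
  "Graph_CP =
    \<lparr>Obj = {G. connected_graph G},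
     Hom = (\<lambda>G H. {\<phi> \<in> verts G \<rightarrow>\<^sub>E verts H. cut_proper G H \<phi>}),
     Ident = (\<lambda>G. \<lambda>v\<in>verts G. v),
     Comp = (\<lambda>G H K \<psi> \<phi>. compose (verts G) \<psi> \<phi>)\<rparr>"

definition Graph_LP :: "('v ugraph, 'v \<Rightarrow> 'v) cat" where
  "Graph_LP =
    \<lparr>Obj = {G. connected_graph G},
     Hom = (\<lambda>G H. {\<phi> \<in> verts G \<rightarrow>\<^sub>E verts H. strongly_line_proper G H \<phi>}),
     Ident = (\<lambda>G. \<lambda>v\<in>verts G. v),
     Comp = (\<lambda>G H K \<psi> \<phi>. compose (verts G) \<psi> \<phi>)\<rparr>"

text \<open>
  The action on a class is the union, over all its representatives, of the classes of their
  preimages, so that well-definedness of \<open>\<phi>\<^sup>-\<^sup>1\<close> on the quotient is not built in.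
\<close>

definition cut_map :: "'u ugraph \<Rightarrow> 'v ugraph \<Rightarrow> ('u \<Rightarrow> 'v) \<Rightarrow> 'v set set \<Rightarrow> 'u set set" where
  "cut_map G H \<phi> =
     (\<lambda>X\<in>carrier (cut_algebra H). \<Union>A\<in>X. cut_class G (preimage G \<phi> A))"

end

theory Submission
  imports Defs
begin

text \<open>
  For graph homomorphisms, cut-properness says exactly that taking preimages maps \<^term>\<open>cut_sets H\<close>
  into \<^term>\<open>cut_sets G\<close> and \<^term>\<open>fin_ideal H\<close> into \<^term>\<open>fin_ideal G\<close>; as preimages commute
  with the set operations, they then act functorially on the quotients. A strongly line-proper
  map is cut-proper because edges between the preimages of a set and of its complement lie in finitely
  many finite fibres, and so do the edges at the vertices over a vertex of finite degree;
  by connectedness, every vertex lies on such an edge unless the graph has only one vertex.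
\<close>

section \<open>The category of Boolean algebras and restriction of functors to subcategories\<close>

lemma category_Bool_cat: "category (Bool_cat :: ('a bool_alg, 'a \<Rightarrow> 'a) cat)"
proof
  fix X :: "'a bool_alg" assume "X \<in> Obj Bool_cat"
  then interpret boolean_alg X by (simp add: Bool_cat_def)
  show "Ident Bool_cat X \<in> Hom Bool_cat X X"
    by (auto simp: Bool_cat_def ba_hom_def meet_closed join_closed compl_closed bot_closed top_closed)
next
  fix X Y Z :: "'a bool_alg" and f g
  assume X: "X \<in> Obj Bool_cat" and fg: "f \<in> Hom Bool_cat X Y" "g \<in> Hom Bool_cat Y Z"
  interpret boolean_alg X using X by (simp add: Bool_cat_def)
  from fg show "Comp Bool_cat X Y Z g f \<in> Hom Bool_cat X Z"
    by (auto simp: Bool_cat_def ba_hom_def PiE_iff Pi_iff compose_def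
        meet_closed join_closed compl_closed bot_closed top_closed)
\<comment> \<open>Only the unit and associativity laws remain. Homomorphisms are extensional, so
  these equations are checked pointwise, with \<open>undefined\<close> on both sides off the
  carrier.\<close>
qed (auto simp: Bool_cat_def ba_hom_def compose_def PiE_iff extensional_def fun_eq_iff)

text \<open>Every functor axiom quantifies over morphisms only universally, so it survives when the
  hom-sets shrink. This carries the functor from \<open>Graph_CP\<close> over to
  \<open>Graph_LP\<close>.\<close>

lemma contravariant_functor_subcategory:
  assumes "contravariant_functor C D F Fm" and "category C'"
    and "Obj C' = Obj C" and "\<And>X Y. X \<in> Obj C \<Longrightarrow> Y \<in> Obj C \<Longrightarrow> Hom C' X Y \<subseteq> Hom C X Y"
    and "Ident C' = Ident C" and "Comp C' = Comp C"
  shows "contravariant_functor C' D F Fm"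
proof -
  interpret contravariant_functor C D F Fm by fact
  interpret C': category C' by fact
  show ?thesis
    using assms(3-6) F_Obj Fm_Hom Fm_Ident Fm_Comp by unfold_locales (auto 0 4 simp: subset_iff)
qed


subsection \<open>Cut algebras\<close>

lemma edges_between_mono:
  "A \<subseteq> A' \<Longrightarrow> B \<subseteq> B' \<Longrightarrow> edges_between G A B \<subseteq> edges_between G A' B'"
  by (auto simp: edges_between_def)

lemma edges_between_commute: "edges_between G A B = edges_between G B A"
  by (auto simp: edges_between_def insert_commute)

lemma edges_between_Un_left:
  "edges_between G (A \<union> A') B = edges_between G A B \<union> edges_between G A' B"
  by (auto simp: edges_between_def)

lemma cut_sets_empty: "{} \<in> cut_sets G"
  by (simp add: cut_sets_def edges_between_def)

lemma cut_sets_compl: "A \<in> cut_sets G \<Longrightarrow> verts G - A \<in> cut_sets G"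
  by (simp add: cut_sets_def edges_between_commute double_diff)

lemma cut_sets_verts: "verts G \<in> cut_sets G"
  using cut_sets_compl[OF cut_sets_empty] by simp

lemma cut_sets_Un:
  assumes "A \<in> cut_sets G" "B \<in> cut_sets G"
  shows "A \<union> B \<in> cut_sets G"
proof -
  \<comment> \<open>An edge leaving the union starts in \<open>A\<close> or in \<open>B\<close> and
    ends outside both, so it already leaves one of them.\<close>
  have "edges_between G (A \<union> B) (verts G - (A \<union> B))
      \<subseteq> edges_between G A (verts G - A) \<union> edges_between G B (verts G - B)"
    unfolding edges_between_Un_left by (intro Un_mono edges_between_mono) auto
  then show ?thesis
    using assms unfolding cut_sets_def by (auto intro: finite_subset)
qed

lemma cut_sets_Int:
  assumes "A \<in> cut_sets G" "B \<in> cut_sets G"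
  shows "A \<inter> B \<in> cut_sets G"
proof -
  have "A \<inter> B = verts G - ((verts G - A) \<union> (verts G - B))"
    using assms by (auto simp: cut_sets_def)
  then show ?thesis
    using assms by (simp add: cut_sets_compl cut_sets_Un)
qed

section \<open>The congruence modulo finite sets of vertices of finite degree\<close>

lemma fin_ideal_subset: "A \<in> fin_ideal G \<Longrightarrow> B \<subseteq> A \<Longrightarrow> B \<in> fin_ideal G"
  by (auto simp: fin_ideal_def intro: finite_subset)

lemma fin_ideal_Un: "A \<in> fin_ideal G \<Longrightarrow> B \<in> fin_ideal G \<Longrightarrow> A \<union> B \<in> fin_ideal G"
  by (auto simp: fin_ideal_def)

text \<open>The congruence \<open>ba_cong\<close> of the cut algebra, with the symmetric difference
  written by set difference instead of complements in \<open>verts G\<close>.\<close>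

definition cut_equiv :: "'v ugraph \<Rightarrow> ('v set \<times> 'v set) set" where
  "cut_equiv G =
     {(A, B). A \<in> cut_sets G \<and> B \<in> cut_sets G \<and> (A - B) \<union> (B - A) \<in> fin_ideal G}"

text \<open>Cut sets consist of vertices, so meeting one with the complement of another is plain set
  difference.\<close>

lemma ba_cong_cut_sets_alg: "ba_cong (cut_sets_alg G) (fin_ideal G) = cut_equiv G"
proof -
  have "(A \<inter> (verts G - B)) \<union> (B \<inter> (verts G - A)) = (A - B) \<union> (B - A)"
    if "A \<in> cut_sets G" "B \<in> cut_sets G" for A B
    using that by (auto simp: cut_sets_def)
  then show ?thesis
    by (auto simp: ba_cong_def cut_equiv_def cut_sets_alg_def)
qed

lemma cut_class_eq: "cut_class G A = cut_equiv G `` {A}"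
  by (simp add: cut_class_def ba_cong_cut_sets_alg)

lemma equiv_cut_equiv: "equiv (cut_sets G) (cut_equiv G)"
proof (rule equivI)
  show "cut_equiv G \<subseteq> cut_sets G \<times> cut_sets G"
    by (auto simp: cut_equiv_def)
  show "refl_on (cut_sets G) (cut_equiv G)"
    by (auto simp: refl_on_def cut_equiv_def fin_ideal_def)
  show "sym (cut_equiv G)"
    by (auto simp: sym_def cut_equiv_def Un_commute)
  show "trans (cut_equiv G)"
  proof (rule transI)
    fix A B C assume *: "(A, B) \<in> cut_equiv G" "(B, C) \<in> cut_equiv G"
    \<comment> \<open>The symmetric difference of \<open>A\<close> and \<open>C\<close> is contained
      in the union of those of \<open>A\<close>, \<open>B\<close> and of \<open>B\<close>,
      \<open>C\<close>.\<close>
    then have "((A - B) \<union> (B - A)) \<union> ((B - C) \<union> (C - B)) \<in> fin_ideal G"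
      by (auto simp: cut_equiv_def intro!: fin_ideal_Un)
    then have "(A - C) \<union> (C - A) \<in> fin_ideal G"
      by (rule fin_ideal_subset) auto
    with * show "(A, C) \<in> cut_equiv G"
      by (simp add: cut_equiv_def)
  qed
qed

section \<open>Compatibility with the set operations, and the induced operations on classes\<close>

lemma cut_equiv_compl:
  assumes "(A, A') \<in> cut_equiv G"
  shows "(verts G - A, verts G - A') \<in> cut_equiv G"
  using assms unfolding cut_equiv_def
  by (auto intro: cut_sets_compl elim: fin_ideal_subset)

text \<open>A vertex on which the two unions disagree is one on which \<open>A\<close>,
  \<open>A'\<close> or \<open>B\<close>, \<open>B'\<close> disagree. The ideal is closed under
  unions and subsets.\<close>

lemma cut_equiv_Un:
  assumes "(A, A') \<in> cut_equiv G" "(B, B') \<in> cut_equiv G"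
  shows "(A \<union> B, A' \<union> B') \<in> cut_equiv G"
proof -
  have "((A - A') \<union> (A' - A)) \<union> ((B - B') \<union> (B' - B)) \<in> fin_ideal G"
    using assms by (auto simp: cut_equiv_def intro!: fin_ideal_Un)
  then have "((A \<union> B) - (A' \<union> B')) \<union> ((A' \<union> B') - (A \<union> B)) \<in> fin_ideal G"
    by (rule fin_ideal_subset) auto
  then show ?thesis
    using assms by (auto simp: cut_equiv_def cut_sets_Un)
qed

lemma cut_equiv_Int:
  assumes "(A, A') \<in> cut_equiv G" "(B, B') \<in> cut_equiv G"
  shows "(A \<inter> B, A' \<inter> B') \<in> cut_equiv G"
proof -
  have "((A - A') \<union> (A' - A)) \<union> ((B - B') \<union> (B' - B)) \<in> fin_ideal G"
    using assms by (auto simp: cut_equiv_def intro!: fin_ideal_Un)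
  then have "((A \<inter> B) - (A' \<inter> B')) \<union> ((A' \<inter> B') - (A \<inter> B)) \<in> fin_ideal G"
    by (rule fin_ideal_subset) auto
  then show ?thesis
    using assms by (auto simp: cut_equiv_def cut_sets_Int)
qed

text \<open>The family of classes is constant by compatibility, and its index set is nonempty
  because it contains \<open>A\<close>, so the union collapses to one class. This evaluates both the
  quotient complement and \<open>cut_map\<close>, which are defined as unions over
  representatives.\<close>

lemma UN_cut_class:
  assumes "A \<in> cut_sets G"
    and "\<And>A'. (A, A') \<in> cut_equiv G \<Longrightarrow> (f A, f A') \<in> cut_equiv H"
  shows "(\<Union>A'\<in>cut_class G A. cut_class H (f A')) = cut_class H (f A)"
proof -
  have "A \<in> cut_class G A"
    using assms(1) equiv_class_self[OF equiv_cut_equiv] by (simp add: cut_class_eq)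
  moreover have "cut_class H (f A') = cut_class H (f A)" if "A' \<in> cut_class G A" for A'
    using assms(2)[of A'] that equiv_class_eq[OF equiv_cut_equiv, of "f A" "f A'" H]
    by (simp add: cut_class_eq)
  ultimately show ?thesis
    by blast
qed

lemma carrier_cut_algebra: "carrier (cut_algebra G) = cut_class G ` cut_sets G"
  by (auto simp: cut_algebra_def ba_quot_def cut_sets_alg_def quotient_def cut_class_def)

lemma cut_algebra_bot: "ba_bot (cut_algebra G) = cut_class G {}"
  by (simp add: cut_algebra_def ba_quot_def cut_sets_alg_def cut_class_def)

lemma cut_algebra_top: "ba_top (cut_algebra G) = cut_class G (verts G)"
  by (simp add: cut_algebra_def ba_quot_def cut_sets_alg_def cut_class_def)

lemma cut_algebra_compl:
  assumes "A \<in> cut_sets G"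
  shows "ba_compl (cut_algebra G) (cut_class G A) = cut_class G (verts G - A)"
proof -
  have "ba_compl (cut_algebra G) (cut_class G A)
      = (\<Union>A'\<in>cut_class G A. cut_class G (verts G - A'))"
    by (simp add: cut_algebra_def ba_quot_def cut_sets_alg_def cut_class_def)
  also have "\<dots> = cut_class G (verts G - A)"
    using assms cut_equiv_compl by (rule UN_cut_class)
  finally show ?thesis .
qed

text \<open>The binary form of the same collapse, for meet and join.\<close>

lemma UN_cut_class2:
  assumes "A \<in> cut_sets G" "B \<in> cut_sets G"
    and "\<And>A' B'. (A, A') \<in> cut_equiv G \<Longrightarrow> (B, B') \<in> cut_equiv G
      \<Longrightarrow> (f A B, f A' B') \<in> cut_equiv G"
  shows "(\<Union>A'\<in>cut_class G A. \<Union>B'\<in>cut_class G B. cut_class G (f A' B')) = cut_class G (f A B)"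
proof -
  have "A \<in> cut_class G A" "B \<in> cut_class G B"
    using assms(1,2) equiv_class_self[OF equiv_cut_equiv] by (simp_all add: cut_class_eq)
  moreover have "cut_class G (f A' B') = cut_class G (f A B)"
    if "A' \<in> cut_class G A" "B' \<in> cut_class G B" for A' B'
    using assms(3)[of A' B'] that equiv_class_eq[OF equiv_cut_equiv, of "f A B" "f A' B'" G]
    by (simp add: cut_class_eq)
  ultimately show ?thesis
    by blast
qed

lemma cut_algebra_meet:
  assumes "A \<in> cut_sets G" "B \<in> cut_sets G"
  shows "ba_meet (cut_algebra G) (cut_class G A) (cut_class G B) = cut_class G (A \<inter> B)"
proof -
  have "ba_meet (cut_algebra G) (cut_class G A) (cut_class G B)
      = (\<Union>A'\<in>cut_class G A. \<Union>B'\<in>cut_class G B. cut_class G (A' \<inter> B'))"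
    by (simp add: cut_algebra_def ba_quot_def cut_sets_alg_def cut_class_def)
  also have "\<dots> = cut_class G (A \<inter> B)"
    using assms cut_equiv_Int by (rule UN_cut_class2)
  finally show ?thesis .
qed

lemma cut_algebra_join:
  assumes "A \<in> cut_sets G" "B \<in> cut_sets G"
  shows "ba_join (cut_algebra G) (cut_class G A) (cut_class G B) = cut_class G (A \<union> B)"
proof -
  have "ba_join (cut_algebra G) (cut_class G A) (cut_class G B)
      = (\<Union>A'\<in>cut_class G A. \<Union>B'\<in>cut_class G B. cut_class G (A' \<union> B'))"
    by (simp add: cut_algebra_def ba_quot_def cut_sets_alg_def cut_class_def)
  also have "\<dots> = cut_class G (A \<union> B)"
    using assms cut_equiv_Un by (rule UN_cut_class2)
  finally show ?thesis .
qed

lemmas cut_sets_intros = cut_sets_empty cut_sets_verts cut_sets_compl cut_sets_Un cut_sets_Int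

lemmas cut_algebra_simps = carrier_cut_algebra cut_algebra_bot cut_algebra_top cut_algebra_compl
  cut_algebra_meet cut_algebra_join

text \<open>Every element is the class of a cut set and the operations act on representatives, so
  each axiom becomes an identity of sets.\<close>

lemma boolean_alg_cut_algebra: "boolean_alg (cut_algebra G)"
proof
  fix X assume "X \<in> carrier (cut_algebra G)"
  then obtain A where A: "A \<in> cut_sets G" and X: "X = cut_class G A"
    by (auto simp: carrier_cut_algebra)
  then have "A \<subseteq> verts G" "A \<inter> (verts G - A) = {}" "A \<union> (verts G - A) = verts G"
    by (auto simp: cut_sets_def)
  with A show "ba_meet (cut_algebra G) X (ba_top (cut_algebra G)) = X"
    and "ba_meet (cut_algebra G) X (ba_compl (cut_algebra G) X) = ba_bot (cut_algebra G)"
    and "ba_join (cut_algebra G) X (ba_compl (cut_algebra G) X) = ba_top (cut_algebra G)"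
    \<comment> \<open>\<open>Un_Diff_cancel\<close> would rewrite
      \<open>A \<union> (verts G - A)\<close> to \<open>A \<union> verts G\<close>; removing it
      keeps the form of the equation supplied above.\<close>
    by (simp_all add: X cut_algebra_simps cut_sets_intros Int_absorb2 del: Un_Diff_cancel)
next
  fix X Y Z
  assume "X \<in> carrier (cut_algebra G)" "Y \<in> carrier (cut_algebra G)" "Z \<in> carrier (cut_algebra G)"
  then obtain A B D where "A \<in> cut_sets G" "B \<in> cut_sets G" "D \<in> cut_sets G"
    and "X = cut_class G A" "Y = cut_class G B" "Z = cut_class G D"
    by (auto simp: carrier_cut_algebra)
  then show "ba_meet (cut_algebra G) (ba_meet (cut_algebra G) X Y) Z =
      ba_meet (cut_algebra G) X (ba_meet (cut_algebra G) Y Z)"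
    and "ba_join (cut_algebra G) (ba_join (cut_algebra G) X Y) Z =
      ba_join (cut_algebra G) X (ba_join (cut_algebra G) Y Z)"
    and "ba_meet (cut_algebra G) X (ba_join (cut_algebra G) Y Z) =
      ba_join (cut_algebra G) (ba_meet (cut_algebra G) X Y) (ba_meet (cut_algebra G) X Z)"
    and "ba_join (cut_algebra G) X (ba_meet (cut_algebra G) Y Z) =
      ba_meet (cut_algebra G) (ba_join (cut_algebra G) X Y) (ba_join (cut_algebra G) X Z)"
    by (simp_all add: cut_algebra_simps cut_sets_intros Int_assoc Un_assoc
        Int_Un_distrib[of A B D] Un_Int_distrib[of A B D])
qed (auto simp: cut_algebra_simps cut_sets_intros Int_commute Un_commute)


subsection \<open>Cut-proper maps\<close>

lemma simple_graph_edge_verts: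
  "simple_graph G \<Longrightarrow> {u, v} \<in> edges G \<Longrightarrow> u \<in> verts G \<and> v \<in> verts G"
  by (auto simp: simple_graph_def)

lemma connected_imp_simple: "connected_graph G \<Longrightarrow> simple_graph G"
  by (simp add: connected_graph_def)

lemma preimage_restrict: "preimage G (\<lambda>v\<in>verts G. v) A = verts G \<inter> A"
  by (auto simp: preimage_def)

lemma preimage_compose:
  "\<phi> \<in> verts G \<rightarrow> verts H
    \<Longrightarrow> preimage G (compose (verts G) \<psi> \<phi>) A = preimage G \<phi> (preimage H \<psi> A)"
  by (auto simp: preimage_def compose_def)

lemma preimage_Diff_verts:
  "\<phi> \<in> verts G \<rightarrow> verts H \<Longrightarrow> preimage G \<phi> (verts H - A) = verts G - preimage G \<phi> A"
  by (auto simp: preimage_def)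

lemma graph_hom_restrict: "simple_graph G \<Longrightarrow> graph_hom G G (\<lambda>v\<in>verts G. v)"
  by (auto simp: graph_hom_def dest: simple_graph_edge_verts)

lemma graph_hom_compose:
  assumes "simple_graph G" "graph_hom G H \<phi>" "graph_hom H K \<psi>"
  shows "graph_hom G K (compose (verts G) \<psi> \<phi>)"
  using assms by (auto simp: graph_hom_def compose_def dest: simple_graph_edge_verts)

text \<open>The preimage of a complement is the complement of the preimage, which turns the edge
  condition into one on cut sets. The vertex condition passes from single vertices to the ideal
  because a finite set has a finite union of fibres as preimage.\<close>

lemma cut_proper_iff:
  "cut_proper G H \<phi> \<longleftrightarrow> graph_hom G H \<phi> \<and>
     (\<forall>A\<in>cut_sets H. preimage G \<phi> A \<in> cut_sets G) \<and>
     (\<forall>A\<in>fin_ideal H. preimage G \<phi> A \<in> fin_ideal G)"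
proof (cases "graph_hom G H \<phi>")
  case True
  then have \<phi>: "\<phi> \<in> verts G \<rightarrow> verts H"
    by (simp add: graph_hom_def)
  have sub: "preimage G \<phi> A \<subseteq> verts G" for A
    by (auto simp: preimage_def)
  have "(\<forall>v\<in>verts H. finite_degree H v \<longrightarrow>
        finite (preimage G \<phi> {v}) \<and> (\<forall>u\<in>preimage G \<phi> {v}. finite_degree G u))
    \<longleftrightarrow> (\<forall>A\<in>fin_ideal H. preimage G \<phi> A \<in> fin_ideal G)" (is "?P \<longleftrightarrow> ?Q")
  proof
    assume P: ?P
    show ?Q
    proof
      fix A assume "A \<in> fin_ideal H"
      then have A: "A \<subseteq> verts H" "finite A" "\<forall>v\<in>A. finite_degree H v"
        by (auto simp: fin_ideal_def)
      have "preimage G \<phi> A = (\<Union>v\<in>A. preimage G \<phi> {v})"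
        by (auto simp: preimage_def)
      moreover have "finite (\<Union>v\<in>A. preimage G \<phi> {v})"
        using P A by blast
      moreover have "\<forall>u\<in>(\<Union>v\<in>A. preimage G \<phi> {v}). finite_degree G u"
        using P A by blast
      ultimately show "preimage G \<phi> A \<in> fin_ideal G"
        using sub[of A] by (simp add: fin_ideal_def)
    qed
  next
    assume Q: ?Q
    \<comment> \<open>Conversely, the singleton of a vertex of finite degree is itself a member of
      the ideal.\<close>
    have "preimage G \<phi> {v} \<in> fin_ideal G" if "v \<in> verts H" "finite_degree H v" for v
      using that by (intro bspec[OF Q]) (simp add: fin_ideal_def)
    then show ?P
      by (simp add: fin_ideal_def)
  qed
  with True sub show ?thesis
    by (simp add: cut_proper_def cut_sets_def preimage_Diff_verts[OF \<phi>])
next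
  case False
  then show ?thesis by (simp add: cut_proper_def)
qed

section \<open>The action on classes, the category of cut-proper maps and its functor\<close>

lemma cut_equiv_preimage:
  assumes "cut_proper G H \<phi>" "(A, B) \<in> cut_equiv H"
  shows "(preimage G \<phi> A, preimage G \<phi> B) \<in> cut_equiv G"
proof -
  have "(preimage G \<phi> A - preimage G \<phi> B) \<union> (preimage G \<phi> B - preimage G \<phi> A)
      = preimage G \<phi> ((A - B) \<union> (B - A))"
    by (auto simp: preimage_def)
  then show ?thesis
    using assms by (auto simp: cut_equiv_def cut_proper_iff)
qed

text \<open>This is well-definedness on the quotient: congruent representatives have congruent
  preimages, so the union defining \<open>cut_map\<close> is a single class.\<close>

lemma cut_map_cut_class:
  assumes "cut_proper G H \<phi>" "A \<in> cut_sets H"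
  shows "cut_map G H \<phi> (cut_class H A) = cut_class G (preimage G \<phi> A)"
  using assms UN_cut_class[OF assms(2) cut_equiv_preimage[OF assms(1)]]
  by (simp add: cut_map_def carrier_cut_algebra)

lemma cut_map_in_ba_hom:
  assumes "cut_proper G H \<phi>"
  shows "cut_map G H \<phi> \<in> ba_hom (cut_algebra H) (cut_algebra G)"
proof -
  have \<phi>: "\<phi> \<in> verts G \<rightarrow> verts H" and pre: "\<And>A. A \<in> cut_sets H \<Longrightarrow> preimage G \<phi> A \<in> cut_sets G"
    using assms by (auto simp: cut_proper_iff graph_hom_def)
  have ops: "preimage G \<phi> (A \<inter> B) = preimage G \<phi> A \<inter> preimage G \<phi> B"
    "preimage G \<phi> (A \<union> B) = preimage G \<phi> A \<union> preimage G \<phi> B"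
    "preimage G \<phi> {} = {}" "preimage G \<phi> (verts H) = verts G" for A B
    using \<phi> by (auto simp: preimage_def)
  have "cut_map G H \<phi> \<in> extensional (carrier (cut_algebra H))"
    by (simp add: cut_map_def)
  then show ?thesis
    by (auto simp: ba_hom_def PiE_iff cut_algebra_simps cut_sets_intros cut_map_cut_class[OF assms]
        pre ops preimage_Diff_verts[OF \<phi>])
qed

text \<open>Treats both graph categories at once: they differ only in the predicate \<open>P\<close>
  on maps, so closure under identities and composites is all that has to be supplied for
  each.\<close>

lemma category_connected_graphs:
  fixes C :: "('v ugraph, 'v \<Rightarrow> 'v) cat"
  assumes C: "Obj C = {G. connected_graph G}"
    "\<And>G H. Hom C G H = {\<phi> \<in> verts G \<rightarrow>\<^sub>E verts H. P G H \<phi>}"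
    "\<And>G. Ident C G = (\<lambda>v\<in>verts G. v)"
    "\<And>G H K \<psi> \<phi>. Comp C G H K \<psi> \<phi> = compose (verts G) \<psi> \<phi>"
    and Id: "\<And>G. simple_graph G \<Longrightarrow> P G G (\<lambda>v\<in>verts G. v)"
    and Comp: "\<And>G H K \<phi> \<psi>. simple_graph G \<Longrightarrow> simple_graph H \<Longrightarrow> P G H \<phi> \<Longrightarrow> P H K \<psi>
      \<Longrightarrow> P G K (compose (verts G) \<psi> \<phi>)"
  shows "category C"
proof
  fix G assume "G \<in> Obj C"
  then show "Ident C G \<in> Hom C G G"
    by (auto simp: C Id connected_imp_simple)
next
  fix G H K \<phi> \<psi> assume "G \<in> Obj C" "H \<in> Obj C" "\<phi> \<in> Hom C G H" "\<psi> \<in> Hom C H K"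
  then show "Comp C G H K \<psi> \<phi> \<in> Hom C G K"
    using Comp[of G H \<phi> K \<psi>] by (auto simp: C connected_imp_simple compose_def PiE_iff)
qed (auto simp: C compose_def PiE_iff extensional_def fun_eq_iff)

lemma cut_proper_restrict:
  assumes "simple_graph G"
  shows "cut_proper G G (\<lambda>v\<in>verts G. v)"
proof -
  \<comment> \<open>The preimage of \<open>A\<close> under the restricted identity is
    \<open>verts G \<inter> A\<close>; members of either family are sets of vertices.\<close>
  have "verts G \<inter> A = A" if "A \<in> cut_sets G \<or> A \<in> fin_ideal G" for A
    using that by (auto simp: cut_sets_def fin_ideal_def)
  then show ?thesis
    using assms by (simp add: cut_proper_iff graph_hom_restrict preimage_restrict)
qed

lemma cut_proper_compose:
  assumes "simple_graph G" "cut_proper G H \<phi>" "cut_proper H K \<psi>"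
  shows "cut_proper G K (compose (verts G) \<psi> \<phi>)"
proof -
  have "\<phi> \<in> verts G \<rightarrow> verts H"
    using assms(2) by (simp add: cut_proper_iff graph_hom_def)
  then show ?thesis
    using assms graph_hom_compose[of G H \<phi> K \<psi>] by (simp add: cut_proper_iff preimage_compose)
qed

lemma category_Graph_CP: "category (Graph_CP :: ('v ugraph, 'v \<Rightarrow> 'v) cat)"
  by (rule category_connected_graphs[where P = cut_proper])
    (simp_all add: Graph_CP_def cut_proper_restrict cut_proper_compose)

lemma contravariant_functor_Graph_CP:
  "contravariant_functor (Graph_CP :: ('v ugraph, 'v \<Rightarrow> 'v) cat) Bool_cat cut_algebra cut_map"
proof -
  interpret CP: category "Graph_CP :: ('v ugraph, 'v \<Rightarrow> 'v) cat"
    by (rule category_Graph_CP)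
  interpret Bool: category "Bool_cat :: ('v set set bool_alg, _) cat"
    by (rule category_Bool_cat)
  show ?thesis
  proof
    fix G :: "'v ugraph" assume "G \<in> Obj Graph_CP"
    then have G: "cut_proper G G (\<lambda>v\<in>verts G. v)"
      by (simp add: Graph_CP_def connected_imp_simple cut_proper_restrict)
    have "cut_map G G (\<lambda>v\<in>verts G. v) X = X" if "X \<in> carrier (cut_algebra G)" for X
    proof -
      from that obtain A where A: "A \<in> cut_sets G" "X = cut_class G A"
        by (auto simp: carrier_cut_algebra)
      then have "verts G \<inter> A = A"
        by (auto simp: cut_sets_def)
      with A show ?thesis
        by (simp add: cut_map_cut_class[OF G] preimage_restrict)
    qed
    then show "cut_map G G (Ident Graph_CP G) = Ident Bool_cat (cut_algebra G)"
      \<comment> \<open>Both sides are extensional on the carrier, so agreement on classes of cut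
        sets suffices.\<close>
      by (intro extensionalityI[where A = "carrier (cut_algebra G)"])
        (simp_all add: Graph_CP_def Bool_cat_def cut_map_def[of G G])
  next
    fix G H K :: "'v ugraph" and \<phi> \<psi>
    assume "G \<in> Obj Graph_CP" "\<phi> \<in> Hom Graph_CP G H" "\<psi> \<in> Hom Graph_CP H K"
    then have G: "simple_graph G" and \<phi>: "\<phi> \<in> verts G \<rightarrow> verts H"
      and cp: "cut_proper G H \<phi>" "cut_proper H K \<psi>"
      by (auto simp: Graph_CP_def connected_imp_simple)
    show "cut_map G K (Comp Graph_CP G H K \<psi> \<phi>)
        = Comp Bool_cat (cut_algebra K) (cut_algebra H) (cut_algebra G)
            (cut_map G H \<phi>) (cut_map H K \<psi>)"
    proof
      fix X
      show "cut_map G K (Comp Graph_CP G H K \<psi> \<phi>) X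
        = Comp Bool_cat (cut_algebra K) (cut_algebra H) (cut_algebra G)
            (cut_map G H \<phi>) (cut_map H K \<psi>) X"
      proof (cases "X \<in> carrier (cut_algebra K)")
        case True
        then obtain A where A: "A \<in> cut_sets K" "X = cut_class K A"
          by (auto simp: carrier_cut_algebra)
        moreover from cp A have "preimage H \<psi> A \<in> cut_sets H"
          by (simp add: cut_proper_iff)
        ultimately show ?thesis
          using True
          by (simp add: Graph_CP_def Bool_cat_def compose_eq preimage_compose[OF \<phi>]
              cut_map_cut_class[OF cut_proper_compose[OF G cp]] cut_map_cut_class[OF cp(1)]
              cut_map_cut_class[OF cp(2)])
      next
        case False
        \<comment> \<open>Off the carrier both sides are \<open>undefined\<close>.\<close>
        then show ?thesis
          by (simp add: Bool_cat_def compose_def cut_map_def)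
      qed
    qed
  qed (simp_all add: Graph_CP_def Bool_cat_def boolean_alg_cut_algebra cut_map_in_ba_hom)
qed


subsection \<open>Strongly line-proper maps\<close>

text \<open>The fibre over \<open>e\<close> of the map that \<phi> induces on edges.\<close>

definition edge_fibre :: "'u ugraph \<Rightarrow> ('u \<Rightarrow> 'v) \<Rightarrow> 'v set \<Rightarrow> 'u set set" where
  "edge_fibre G \<phi> e = {{u, v} | u v. {u, v} \<in> edges G \<and> {\<phi> u, \<phi> v} = e}"

lemma strongly_line_proper_iff:
  "strongly_line_proper G H \<phi> \<longleftrightarrow>
     graph_hom G H \<phi> \<and> (\<forall>e\<in>edges H. finite (edge_fibre G \<phi> e))"
  by (simp add: strongly_line_proper_def edge_fibre_def)

lemma strongly_line_proper_restrict:
  assumes "simple_graph G"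
  shows "strongly_line_proper G G (\<lambda>v\<in>verts G. v)"
proof -
  have "edge_fibre G (\<lambda>v\<in>verts G. v) e \<subseteq> {e}" for e
    using simple_graph_edge_verts[OF assms] by (auto simp: edge_fibre_def)
  then show ?thesis
    using assms by (auto simp: strongly_line_proper_iff graph_hom_restrict intro: finite_subset)
qed

lemma strongly_line_proper_compose:
  assumes G: "simple_graph G" and \<phi>: "strongly_line_proper G H \<phi>"
    and \<psi>: "strongly_line_proper H K \<psi>"
  shows "strongly_line_proper G K (compose (verts G) \<psi> \<phi>)"
proof -
  have "finite (edge_fibre G (compose (verts G) \<psi> \<phi>) e)" if "e \<in> edges K" for e
  proof -
    \<comment> \<open>An edge over \<open>e\<close> under the composite maps by \<phi> to an edge
      over \<open>e\<close> under \<psi>. Hence finitely many finite fibres of \<phi> cover the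
      composite fibre.\<close>
    have "edge_fibre G (compose (verts G) \<psi> \<phi>) e \<subseteq> (\<Union>d\<in>edge_fibre H \<psi> e. edge_fibre G \<phi> d)"
    proof
      fix d assume "d \<in> edge_fibre G (compose (verts G) \<psi> \<phi>) e"
      then obtain u v where uv: "d = {u, v}" "{u, v} \<in> edges G"
        and "{compose (verts G) \<psi> \<phi> u, compose (verts G) \<psi> \<phi> v} = e"
        by (auto simp: edge_fibre_def)
      \<comment> \<open>The ends of an edge are vertices of \<open>G\<close>, so
        \<open>compose\<close> takes its proper value there and not the default.\<close>
      with simple_graph_edge_verts[OF G] have "{\<psi> (\<phi> u), \<psi> (\<phi> v)} = e"
        by (simp add: compose_def)
      with uv \<phi> have "{\<phi> u, \<phi> v} \<in> edge_fibre H \<psi> e"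
        unfolding edge_fibre_def strongly_line_proper_def graph_hom_def by blast
      moreover from uv have "d \<in> edge_fibre G \<phi> {\<phi> u, \<phi> v}"
        unfolding edge_fibre_def by blast
      ultimately show "d \<in> (\<Union>d\<in>edge_fibre H \<psi> e. edge_fibre G \<phi> d)"
        by blast
    qed
    moreover have "finite (\<Union>d\<in>edge_fibre H \<psi> e. edge_fibre G \<phi> d)"
    proof (rule finite_UN_I)
      show "finite (edge_fibre H \<psi> e)"
        using \<psi> that by (simp add: strongly_line_proper_iff)
      show "finite (edge_fibre G \<phi> d)" if "d \<in> edge_fibre H \<psi> e" for d
        using \<phi> that by (auto simp: strongly_line_proper_iff edge_fibre_def[of H])
    qed
    ultimately show ?thesis
      by (rule finite_subset)
  qed
  then show ?thesis
    using assms graph_hom_compose by (auto simp: strongly_line_proper_iff)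
qed

lemma category_Graph_LP: "category (Graph_LP :: ('v ugraph, 'v \<Rightarrow> 'v) cat)"
  by (rule category_connected_graphs[where P = strongly_line_proper])
    (simp_all add: Graph_LP_def strongly_line_proper_restrict strongly_line_proper_compose)

section \<open>Strongly line-proper maps are cut-proper\<close>

lemma simple_graph_edgeE:
  assumes "simple_graph G" "e \<in> edges G" "u \<in> e"
  obtains w where "e = {u, w}"
proof -
  have "card e = 2"
    using assms by (simp add: simple_graph_def)
  with \<open>u \<in> e\<close> that show thesis
    by (auto simp: card_2_iff)
qed

text \<open>A path from \<open>u\<close> to a different vertex would have to begin with an edge at
  \<open>u\<close>.\<close>

lemma connected_graph_no_edge_at:
  assumes G: "connected_graph G" and u: "u \<in> verts G" and no_edge: "\<forall>e\<in>edges G. u \<notin> e"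
  shows "verts G = {u}"
proof -
  have "v = u" if "v \<in> verts G" for v
  proof -
    have "(u, v) \<in> {(x, y). {x, y} \<in> edges G}\<^sup>*"
      using G u that by (simp add: connected_graph_def)
    then show ?thesis
      using no_edge by (cases rule: converse_rtranclE) auto
  qed
  with u show ?thesis by blast
qed

lemma strongly_line_proper_imp_cut_proper:
  assumes G: "connected_graph G" and \<phi>: "strongly_line_proper G H \<phi>"
  shows "cut_proper G H \<phi>"
proof -
  note simple = connected_imp_simple[OF G]
  have hom: "graph_hom G H \<phi>"
    and fibre: "\<And>e. e \<in> edges H \<Longrightarrow> finite (edge_fibre G \<phi> e)"
    using \<phi> by (auto simp: strongly_line_proper_iff)
  have edge: "{\<phi> u, \<phi> v} \<in> edges H" "{u, v} \<in> edge_fibre G \<phi> {\<phi> u, \<phi> v}"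
    if "{u, v} \<in> edges G" for u v
    using hom that by (auto simp: graph_hom_def edge_fibre_def)
  have cut: "finite (edges_between G (preimage G \<phi> A) (preimage G \<phi> (verts H - A)))"
    if "finite (edges_between H A (verts H - A))" for A
  proof (rule finite_subset)
    \<comment> \<open>An edge between the two preimages maps to an edge of the finite cut of
      \<open>A\<close>, so it lies in one of finitely many finite fibres.\<close>
    show "edges_between G (preimage G \<phi> A) (preimage G \<phi> (verts H - A))
        \<subseteq> (\<Union>e\<in>edges_between H A (verts H - A). edge_fibre G \<phi> e)"
    proof
      fix d assume "d \<in> edges_between G (preimage G \<phi> A) (preimage G \<phi> (verts H - A))"
      then obtain u v where d: "d = {u, v}" "{u, v} \<in> edges G" "\<phi> u \<in> A" "\<phi> v \<in> verts H - A"
        by (auto simp: edges_between_def preimage_def)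
      with edge have "{\<phi> u, \<phi> v} \<in> edges_between H A (verts H - A)"
        unfolding edges_between_def by blast
      with d edge show "d \<in> (\<Union>e\<in>edges_between H A (verts H - A). edge_fibre G \<phi> e)"
        by blast
    qed
    show "finite (\<Union>e\<in>edges_between H A (verts H - A). edge_fibre G \<phi> e)"
      using that fibre by (auto simp: edges_between_def)
  qed
  have deg: "finite (preimage G \<phi> {v}) \<and> (\<forall>u\<in>preimage G \<phi> {v}. finite_degree G u)"
    if "finite_degree H v" for v
  proof -
    \<comment> \<open>All edges of \<open>G\<close> lying over edges at \<open>v\<close>: a finite
      set, because \<open>v\<close> has finite degree. It contains every edge at a vertex over
      \<open>v\<close>, which bounds the degrees there.\<close>
    define D where "D = (\<Union>e\<in>{e \<in> edges H. v \<in> e}. edge_fibre G \<phi> e)"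
    have D: "finite D"
      using that fibre by (auto simp: D_def finite_degree_def)
    have star: "{e \<in> edges G. u \<in> e} \<subseteq> D" if "u \<in> preimage G \<phi> {v}" for u
    proof
      fix e assume "e \<in> {e \<in> edges G. u \<in> e}"
      then obtain w where "e = {u, w}" "{u, w} \<in> edges G"
        using simple_graph_edgeE[OF simple] by blast
      with edge[of u w] that show "e \<in> D"
        by (auto simp: D_def preimage_def)
    qed
    have "finite (preimage G \<phi> {v})"
    \<comment> \<open>If the edges in \<open>D\<close> cover the fibre over \<open>v\<close>, it
      lies in a finite union of sets with at most two elements. Otherwise some vertex of it has no
      edge at all, and connectedness leaves \<open>G\<close> with that single vertex.\<close>
    proof (cases "preimage G \<phi> {v} \<subseteq> \<Union>D")
      case True
      have "finite e" if "e \<in> D" for e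
        using that by (auto simp: D_def edge_fibre_def)
      with D True show ?thesis
        by (auto intro: finite_subset)
    next
      case False
      then obtain u where u: "u \<in> preimage G \<phi> {v}" "u \<notin> \<Union>D"
        by blast
      with star have "\<forall>e\<in>edges G. u \<notin> e"
        by blast
      with G u have "verts G = {u}"
        by (intro connected_graph_no_edge_at) (auto simp: preimage_def)
      then show ?thesis
        by (simp add: preimage_def)
    qed
    with star D show ?thesis
      by (auto simp: finite_degree_def intro: finite_subset)
  qed
  from hom cut deg show ?thesis
    by (simp add: cut_proper_def)
qed

lemma Hom_Graph_LP_subset_Graph_CP:
  "G \<in> Obj Graph_CP \<Longrightarrow> Hom Graph_LP G H \<subseteq> Hom Graph_CP G H"
  by (auto simp: Graph_LP_def Graph_CP_def strongly_line_proper_imp_cut_proper)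

lemma contravariant_functor_Graph_LP:
  "contravariant_functor (Graph_LP :: ('v ugraph, 'v \<Rightarrow> 'v) cat) Bool_cat cut_algebra cut_map"
  using contravariant_functor_Graph_CP category_Graph_LP
proof (rule contravariant_functor_subcategory)
  show "Hom Graph_LP G H \<subseteq> Hom Graph_CP G H" if "G \<in> Obj Graph_CP" for G H :: "'v ugraph"
    using that by (rule Hom_Graph_LP_subset_Graph_CP)
qed (simp_all add: Graph_LP_def Graph_CP_def)

text \<open>The two quantified clauses say that the union over representatives in
  \<open>cut_map\<close> really is the class of one preimage, for each kind of morphism.\<close>

theorem theorem23:
  "category (Graph_CP :: ('v ugraph, 'v \<Rightarrow> 'v) cat) \<and>
   contravariant_functor (Graph_CP :: ('v ugraph, 'v \<Rightarrow> 'v) cat) Bool_cat cut_algebra cut_map \<and>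
   (\<forall>G \<in> Obj Graph_CP. \<forall>H \<in> Obj Graph_CP. \<forall>\<phi> \<in> Hom Graph_CP G (H :: 'v ugraph).
      \<forall>A \<in> cut_sets H.
        preimage G \<phi> A \<in> cut_sets G \<and>
        cut_map G H \<phi> (cut_class H A) = cut_class G (preimage G \<phi> A)) \<and>
   category (Graph_LP :: ('v ugraph, 'v \<Rightarrow> 'v) cat) \<and>
   contravariant_functor (Graph_LP :: ('v ugraph, 'v \<Rightarrow> 'v) cat) Bool_cat cut_algebra cut_map \<and>
   (\<forall>G \<in> Obj Graph_LP. \<forall>H \<in> Obj Graph_LP. \<forall>\<phi> \<in> Hom Graph_LP G (H :: 'v ugraph).
      \<forall>A \<in> cut_sets H.
        preimage G \<phi> A \<in> cut_sets G \<and>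
        cut_map G H \<phi> (cut_class H A) = cut_class G (preimage G \<phi> A))"
proof (intro conjI ballI)
  fix G H :: "'v ugraph" and \<phi> A
  assume \<phi>: "\<phi> \<in> Hom Graph_CP G H" and A: "A \<in> cut_sets H"
  from \<phi> have cp: "cut_proper G H \<phi>"
    by (simp add: Graph_CP_def)
  with A show "preimage G \<phi> A \<in> cut_sets G"
    by (simp add: cut_proper_iff)
  from cp A show "cut_map G H \<phi> (cut_class H A) = cut_class G (preimage G \<phi> A)"
    by (rule cut_map_cut_class)
next
  fix G H :: "'v ugraph" and \<phi> A
  assume "G \<in> Obj Graph_LP" "\<phi> \<in> Hom Graph_LP G H" and A: "A \<in> cut_sets H"
  then have cp: "cut_proper G H \<phi>"
    by (simp add: Graph_LP_def strongly_line_proper_imp_cut_proper)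
  with A show "preimage G \<phi> A \<in> cut_sets G"
    by (simp add: cut_proper_iff)
  from cp A show "cut_map G H \<phi> (cut_class H A) = cut_class G (preimage G \<phi> A)"
    by (rule cut_map_cut_class)
qed (fact category_Graph_CP contravariant_functor_Graph_CP category_Graph_LP
    contravariant_functor_Graph_LP)+

end
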